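(* Let $a,b,c,d$ be non-zero complex numbers with $|a|^2+|b|^2=1$ and $|c|^2+|d|^2=1$. For $j=0,1$ let $$\nu_j=\left(\frac{1+(-1)^j\sqrt{1-4|bcd|^2}}{2}\right)^{1/2},\quad |x_j\rangle=\begin{bmatrix}c(\nu_j^2-|bd|^2)\\-a^*d\,\nu_j^2\end{bmatrix},\quad |y_j\rangle=\begin{bmatrix}-a^*b|d|^2\\ \nu_j^2-|bd|^2\end{bmatrix}.$$ Suppose that an orthonormal basis of $\mathbb{C}^2\otimes\mathbb{C}^2$ consisting of two product states and two entangled states contains the product states $|00\rangle_{AB}$ and $a|10\rangle_{AB}+b|11\rangle_{AB}$ and the entangled state with Schmidt decomposition $$|\mathrm{ppEe}\rangle_{AB}=\sum_{j=0}^1\nu_j\left(\frac{|x_j\rangle_A}{\||x_j\rangle\|}\right)\otimes\left(\frac{|y_j^*\rangle_B}{\||y_j\rangle\|}\right).$$ Then, up to a global phase, the other entangled state of the basis has the Schmidt decomposition $$|\mathrm{ppeE}\rangle_{AB}=\sum_{j=0}^1\nu_j\left(\frac{|x_{j\oplus1}\rangle_A}{\||x_{j\oplus1}\rangle\|}\right)\otimes\left(\frac{|w_j^*\rangle_B}{\||w_j\rangle\|}\right),\qquad |w_j^*\rangle=\begin{bmatrix}-ab^*|c|^2\\ \nu_j^2-|bc|^2\end{bmatrix}.$$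
   Context: $|0\rangle,|1\rangle$ is the standard basis of $\mathbb{C}^2$, $|jk\rangle_{AB}=|j\rangle_A\otimes|k\rangle_B$, column vectors are with respect to the standard basis, $^*$ on scalars is complex conjugation, $|y^*\rangle$ is the entrywise complex conjugate of $|y\rangle$, and $j\oplus1$ is addition modulo 2. A state is a unit vector; a state in $\mathbb{C}^2\otimes\mathbb{C}^2$ is a product state if it equals $|u\rangle\otimes|v\rangle$, and entangled otherwise. A Schmidt decomposition of a state is an expression $\sum_j\lambda_j|u_j\rangle\otimes|v_j\rangle$ with $\lambda_j\ge 0$ and $\{|u_j\rangle\}$, $\{|v_j\rangle\}$ orthonormal families in $\mathbb{C}^2$. A global phase is a complex number of modulus one multiplying the state. *)

theory Defs
  imports "HOL-Analysis.Analysis"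
begin

type_synonym qubit = "complex ^ 2"

text \<open>The component of a vector of \<open>qubit2\<close> at \<open>(i, j)\<close> has row index \<open>i\<close> in system A
  and \<open>j\<close> in system B.\<close>

type_synonym qubit2 = "complex ^ (2 \<times> 2)"

text \<open>The library only provides the real inner product on these vector types. Conjugate-linear
  in the first argument; the norm it induces is the library's \<open>norm\<close>.\<close>

definition cinner :: "complex ^ 'n \<Rightarrow> complex ^ 'n \<Rightarrow> complex" where
  "cinner x y = (\<Sum>i\<in>UNIV. cnj (x $ i) * y $ i)"

definition vec_cnj :: "complex ^ 'n \<Rightarrow> complex ^ 'n" where
  "vec_cnj x = (\<chi> i. cnj (x $ i))"

definition tensor :: "qubit \<Rightarrow> qubit \<Rightarrow> qubit2" (infixl "\<otimes>\<^sub>q" 75) where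
  "u \<otimes>\<^sub>q v = (\<chi> p. u $ fst p * v $ snd p)"

text \<open>The library numbers the entries of \<open>vector [p, q]\<close> by 1 and 2, so the ket with label 0 has
  its non-zero entry at index 1, and the ket with label 1 at index 2.\<close>

definition ket0 :: qubit where "ket0 = vector [1, 0]"

definition ket1 :: qubit where "ket1 = vector [0, 1]"

definition is_state :: "complex ^ 'n \<Rightarrow> bool" where
  "is_state \<psi> \<longleftrightarrow> norm \<psi> = 1"

definition product_state :: "qubit2 \<Rightarrow> bool" where
  "product_state \<psi> \<longleftrightarrow> is_state \<psi> \<and> (\<exists>u v. \<psi> = u \<otimes>\<^sub>q v)"

definition entangled_state :: "qubit2 \<Rightarrow> bool" where
  "entangled_state \<psi> \<longleftrightarrow> is_state \<psi> \<and> \<not> product_state \<psi>"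

definition orthonormal_family :: "'i set \<Rightarrow> ('i \<Rightarrow> complex ^ 'n) \<Rightarrow> bool" where
  "orthonormal_family J u \<longleftrightarrow> (\<forall>i\<in>J. \<forall>j\<in>J. cinner (u i) (u j) = (if i = j then 1 else 0))"

text \<open>\<open>vec.span\<close> is the linear span over the complex scalars, unlike \<open>span\<close>.\<close>

definition orthonormal_basis :: "(complex ^ 'n) set \<Rightarrow> bool" where
  "orthonormal_basis B \<longleftrightarrow> orthonormal_family B (\<lambda>\<psi>. \<psi>) \<and> vec.span B = UNIV"

definition schmidt_decomposition ::
    "qubit2 \<Rightarrow> 'i set \<Rightarrow> ('i \<Rightarrow> real) \<Rightarrow> ('i \<Rightarrow> qubit) \<Rightarrow> ('i \<Rightarrow> qubit) \<Rightarrow> bool" where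
  "schmidt_decomposition \<psi> J \<mu> u v \<longleftrightarrow>
     finite J \<and> (\<forall>j\<in>J. \<mu> j \<ge> 0) \<and> orthonormal_family J u \<and> orthonormal_family J v \<and>
     \<psi> = (\<Sum>j\<in>J. \<mu> j *\<^sub>R (u j \<otimes>\<^sub>q v j))"

definition nu :: "complex \<Rightarrow> complex \<Rightarrow> complex \<Rightarrow> nat \<Rightarrow> real" where
  "nu b c d j = sqrt ((1 + (-1) ^ j * sqrt (1 - 4 * (cmod (b * c * d))\<^sup>2)) / 2)"

definition xvec :: "complex \<Rightarrow> complex \<Rightarrow> complex \<Rightarrow> complex \<Rightarrow> nat \<Rightarrow> qubit" where
  "xvec a b c d j = vector
     [c * of_real ((nu b c d j)\<^sup>2 - (cmod (b * d))\<^sup>2),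
      - cnj a * d * of_real ((nu b c d j)\<^sup>2)]"

definition yvec :: "complex \<Rightarrow> complex \<Rightarrow> complex \<Rightarrow> complex \<Rightarrow> nat \<Rightarrow> qubit" where
  "yvec a b c d j = vector
     [- cnj a * b * of_real ((cmod d)\<^sup>2),
      of_real ((nu b c d j)\<^sup>2 - (cmod (b * d))\<^sup>2)]"

text \<open>The vector whose entrywise conjugate is the displayed column.\<close>

definition wvec :: "complex \<Rightarrow> complex \<Rightarrow> complex \<Rightarrow> complex \<Rightarrow> nat \<Rightarrow> qubit" where
  "wvec a b c d j = vec_cnj (vector
     [- a * cnj b * of_real ((cmod c)\<^sup>2),
      of_real ((nu b c d j)\<^sup>2 - (cmod (b * c))\<^sup>2)])"

end

theory Submission
  imports Defs
begin

text \<open>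
  Read a state as its \<open>2 \<times> 2\<close> coefficient matrix. The states orthogonal to the two product states
  are the matrices \<open>[[0, p], [q b\<^sup>*, - q a\<^sup>*]]\<close>; here ppEe is \<open>M\<close> with \<open>(p, q) = (c, d)\<close>, so the other
  entangled state is, up to a phase, \<open>N\<close> with \<open>(p, q) = (d\<^sup>*, - c\<^sup>*)\<close>. Since \<open>M M\<^sup>\<dagger> + N N\<^sup>\<dagger> = 1\<close> and
  \<open>\<nu>\<^sub>0\<^sup>2 + \<nu>\<^sub>1\<^sup>2 = 1\<close>, the left singular vectors of \<open>M\<close> are those of \<open>N\<close> with the indices swapped.
  The right singular vectors are read off from \<open>x\<^sub>j\<^sup>\<dagger> M\<close> and \<open>x\<^sub>1\<^sub>-\<^sub>j\<^sup>\<dagger> N\<close>, and for \<open>N\<close> the same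
  phase \<open>- c\<^sup>* d\<^sup>* / |cd|\<close> occurs for both \<open>j\<close>, so that it is a global one.
\<close>

section \<open>Inner products in coordinates and under conjugation\<close>

lemma cinner_qubit: "cinner u v = cnj (u $ 1) * v $ 1 + cnj (u $ 2) * v $ 2"
  for u v :: qubit
  by (simp add: cinner_def UNIV_2)

lemma cinner_self: "cinner x x = of_real ((norm x)\<^sup>2)"
proof -
  have "(norm x)\<^sup>2 = (\<Sum>i\<in>UNIV. (cmod (x $ i))\<^sup>2)"
    by (simp add: norm_vec_def L2_set_def sum_nonneg)
  then show ?thesis
    by (simp only: cinner_def of_real_sum complex_norm_square) (simp add: mult.commute)
qed

lemma cinner_scaleR: "cinner (r *\<^sub>R x) (s *\<^sub>R y) = of_real (r * s) * cinner x y"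
  by (simp add: cinner_def sum_distrib_left
      scaleR_conv_of_real[where 'a = complex] mult_ac)

lemma norm_vec_cnj: "norm (vec_cnj x) = norm x"
  by (simp add: norm_vec_def vec_cnj_def)

lemma vec_cnj_nonzero: "x \<noteq> 0 \<Longrightarrow> vec_cnj x \<noteq> 0"
  by (metis norm_vec_cnj norm_eq_zero)

lemma vec_cnj_nth: "vec_cnj x $ i = cnj (x $ i)"
  by (simp add: vec_cnj_def)

lemma cinner_vec_cnj: "cinner (vec_cnj x) (vec_cnj y) = cnj (cinner x y)"
  by (simp add: cinner_def vec_cnj_def)

lemma sum_qubit2: "(\<Sum>p\<in>UNIV. f p) = f (1, 1) + f (1, 2) + f (2, 1) + f (2, 2)"
  for f :: "2 \<times> 2 \<Rightarrow> 'b::comm_monoid_add"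
proof -
  have "(\<Sum>p\<in>UNIV. f p) = (\<Sum>i\<in>UNIV. \<Sum>k\<in>UNIV. f (i, k))"
    by (simp add: sum.cartesian_product UNIV_Times_UNIV[symmetric] del: UNIV_Times_UNIV)
  then show ?thesis
    by (simp add: sum_2 add.assoc)
qed

lemma cinner_qubit2:
  "cinner u v = cnj (u $ (1, 1)) * v $ (1, 1) + cnj (u $ (1, 2)) * v $ (1, 2)
     + cnj (u $ (2, 1)) * v $ (2, 1) + cnj (u $ (2, 2)) * v $ (2, 2)"
  for u v :: qubit2
  by (simp add: cinner_def sum_qubit2)

section \<open>Orthonormal pairs and expansions along them\<close>

lemma orthonormal_family_normalize:
  assumes "\<And>j. j \<in> J \<Longrightarrow> f j \<noteq> 0"
    and "\<And>i j. i \<in> J \<Longrightarrow> j \<in> J \<Longrightarrow> i \<noteq> j \<Longrightarrow> cinner (f i) (f j) = 0"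
  shows "orthonormal_family J (\<lambda>j. f j /\<^sub>R norm (f j))"
  unfolding orthonormal_family_def
  using assms by (auto simp: cinner_scaleR cinner_self power2_eq_square field_simps)

text \<open>For the square matrix with columns \<open>u 0\<close>, \<open>u 1\<close>,
  orthonormality says that the adjoint is a left inverse; it is then also a right inverse, which is
  completeness.\<close>

lemma resolution_of_identity:
  fixes u :: "nat \<Rightarrow> qubit"
  assumes "orthonormal_family {..<2} u"
  shows "u 0 $ i * cnj (u 0 $ k) + u 1 $ i * cnj (u 1 $ k) = (if i = k then 1 else 0)"
proof -
  \<comment> \<open>\<open>P\<close> translates the matrix indices 1, 2 into the labels 0,
    1.\<close>
  define P :: "2 \<Rightarrow> nat" where "P = (\<lambda>i. if i = 1 then 0 else 1)"
  define A :: "complex^2^2" where "A = (\<chi> i k. cnj (u (P i) $ k))"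
  define C :: "complex^2^2" where "C = (\<chi> i k. u (P k) $ i)"
  have "A ** C = mat 1"
    using assms
    by (auto simp: matrix_matrix_mult_def A_def C_def mat_def vec_eq_iff P_def forall_2
        orthonormal_family_def cinner_def)
  then have "C ** A = mat 1"
    by (simp add: matrix_left_right_inverse)
  then have "(C ** A) $ i $ k = mat 1 $ i $ k"
    by simp
  then show ?thesis
    by (simp add: matrix_matrix_mult_def A_def C_def mat_def P_def sum_2)
qed

text \<open>Contracting system A of \<open>\<psi>\<close> with \<open>u j\<close> yields
  \<open>\<mu> j\<close> times \<open>v j\<close>; completeness of \<open>u\<close> reassembles
  \<open>\<psi>\<close> from these contractions.\<close>

lemma schmidt_expansion:
  fixes u v :: "nat \<Rightarrow> qubit"
  assumes u: "orthonormal_family {..<2} u"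
    and uv: "\<And>j k. j < 2 \<Longrightarrow>
      cnj (u j $ 1) * \<psi> $ (1, k) + cnj (u j $ 2) * \<psi> $ (2, k) = of_real (\<mu> j) * v j $ k"
  shows "\<psi> = (\<Sum>j<2. \<mu> j *\<^sub>R (u j \<otimes>\<^sub>q v j))"
proof -
  have "\<psi> $ (i, k) = (\<Sum>j<2. \<mu> j *\<^sub>R (u j \<otimes>\<^sub>q v j)) $ (i, k)" for i k
  proof -
    note R = resolution_of_identity[OF u]
    have "(\<Sum>j<2. \<mu> j *\<^sub>R (u j \<otimes>\<^sub>q v j)) $ (i, k)
        = u 0 $ i * (of_real (\<mu> 0) * v 0 $ k) + u 1 $ i * (of_real (\<mu> 1) * v 1 $ k)"
      by (simp add: numeral_2_eq_2 tensor_def scaleR_conv_of_real[where 'a = complex] mult_ac)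
    also have "\<dots> = (u 0 $ i * cnj (u 0 $ 1) + u 1 $ i * cnj (u 1 $ 1)) * \<psi> $ (1, k)
        + (u 0 $ i * cnj (u 0 $ 2) + u 1 $ i * cnj (u 1 $ 2)) * \<psi> $ (2, k)"
      by (simp add: uv[symmetric] algebra_simps)
    also have "\<dots> = \<psi> $ (i, k)"
      unfolding R using exhaust_2[of i] by auto
    finally show ?thesis by simp
  qed
  then show ?thesis
    by (simp add: vec_eq_iff)
qed

text \<open>Allows the contractions to be computed with unnormalized vectors:
  \<open>\<kappa> j\<close> is the factor found there, and the norm condition turns it into
  \<open>\<mu> j\<close>.\<close>

lemma schmidt_expansion_normalized:
  fixes f g :: "nat \<Rightarrow> qubit"
  assumes f: "orthonormal_family {..<2} (\<lambda>j. f j /\<^sub>R norm (f j))"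
    and f0: "\<And>j. j < 2 \<Longrightarrow> f j \<noteq> 0" and g0: "\<And>j. j < 2 \<Longrightarrow> g j \<noteq> 0"
    and fg: "\<And>j k. j < 2 \<Longrightarrow>
      cnj (f j $ 1) * \<psi> $ (1, k) + cnj (f j $ 2) * \<psi> $ (2, k) = of_real (\<kappa> j) * g j $ k"
    and \<kappa>: "\<And>j. j < 2 \<Longrightarrow> \<kappa> j * norm (g j) = \<mu> j * norm (f j)"
  shows "\<psi> = (\<Sum>j<2. \<mu> j *\<^sub>R ((f j /\<^sub>R norm (f j)) \<otimes>\<^sub>q (g j /\<^sub>R norm (g j))))"
proof (rule schmidt_expansion[OF f])
  fix j :: nat and k :: 2
  assume j: "j < 2"
  have "cnj ((f j /\<^sub>R norm (f j)) $ 1) * \<psi> $ (1, k) + cnj ((f j /\<^sub>R norm (f j)) $ 2) * \<psi> $ (2, k)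
      = of_real (inverse (norm (f j))) * (of_real (\<kappa> j) * g j $ k)"
    unfolding fg[OF j, symmetric]
    by (simp add: scaleR_conv_of_real[where 'a = complex] algebra_simps)
  also have "\<dots> = of_real (\<kappa> j / norm (f j)) * g j $ k"
    by (simp add: field_simps)
  also have "\<kappa> j / norm (f j) = \<mu> j / norm (g j)"
    using \<kappa>[OF j] f0[OF j] g0[OF j] by (simp add: field_simps)
  finally show "cnj ((f j /\<^sub>R norm (f j)) $ 1) * \<psi> $ (1, k)
      + cnj ((f j /\<^sub>R norm (f j)) $ 2) * \<psi> $ (2, k)
      = of_real (\<mu> j) * (g j /\<^sub>R norm (g j)) $ k"
    by (simp add: scaleR_conv_of_real[where 'a = complex] field_simps)
qed

section \<open>The squares of the Schmidt coefficients as roots of a quadratic\<close>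

locale amplitudes =
  fixes a b c d :: complex
  assumes nz: "a \<noteq> 0" "b \<noteq> 0" "c \<noteq> 0" "d \<noteq> 0"
    and ab: "(cmod a)\<^sup>2 + (cmod b)\<^sup>2 = 1"
    and cd: "(cmod c)\<^sup>2 + (cmod d)\<^sup>2 = 1"
begin

abbreviation n :: "nat \<Rightarrow> real" where "n j \<equiv> (nu b c d j)\<^sup>2"

lemma ab_cnj: "a * cnj a + b * cnj b = 1"
  using ab by (simp only: complex_norm_square[symmetric] of_real_add[symmetric]) simp

lemma cd_cnj: "c * cnj c + d * cnj d = 1"
  using cd by (simp only: complex_norm_square[symmetric] of_real_add[symmetric]) simp

text \<open>Since |c|^2 and |d|^2 sum to 1, their product is at most 1/4; moreover |b| < 1 because a
  is non-zero.\<close>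

lemma disc_pos: "4 * (cmod (b * c * d))\<^sup>2 < 1"
proof -
  let ?p = "(cmod c)\<^sup>2"
  have "(2 * ?p - 1)\<^sup>2 \<ge> 0" by simp
  then have "4 * (?p * (1 - ?p)) \<le> 1" 
    by (simp add: power2_eq_square algebra_simps)
  moreover have "(cmod d)\<^sup>2 = 1 - ?p" using cd by simp
  ultimately have 1: "4 * (?p * (cmod d)\<^sup>2) \<le> 1" by simp
  have "(cmod b)\<^sup>2 < 1" using ab nz(1) by (smt (verit) zero_less_norm_iff zero_less_power)
  moreover have "?p * (cmod d)\<^sup>2 > 0" using nz by simp
  ultimately have "(cmod b)\<^sup>2 * (?p * (cmod d)\<^sup>2) < 1 * (?p * (cmod d)\<^sup>2)"
    by (rule mult_strict_right_mono)
  with 1 show ?thesis by (simp add: norm_mult power_mult_distrib)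
qed

lemma n_eq: "n j = (1 + (-1) ^ j * sqrt (1 - 4 * (cmod (b * c * d))\<^sup>2)) / 2"
proof -
  have "sqrt (1 - 4 * (cmod (b * c * d))\<^sup>2) \<le> 1" by simp
  moreover have "sqrt (1 - 4 * (cmod (b * c * d))\<^sup>2) \<ge> 0" using disc_pos by simp
  ultimately have "(1 + (-1) ^ j * sqrt (1 - 4 * (cmod (b * c * d))\<^sup>2)) / 2 \<ge> 0"
    by (cases "even j") auto
  then show ?thesis by (simp add: nu_def)
qed

lemma nu_nonneg: "nu b c d j \<ge> 0"
proof -
  have "sqrt (1 - 4 * (cmod (b * c * d))\<^sup>2) \<le> 1" by simp
  moreover have "sqrt (1 - 4 * (cmod (b * c * d))\<^sup>2) \<ge> 0" using disc_pos by simp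
  ultimately show ?thesis
    unfolding nu_def by (cases "even j") auto
qed

lemma n_sum: "n 0 + n 1 = 1"
  unfolding n_eq by (simp add: field_simps)

text \<open>With \<open>n_sum\<close>, this makes \<open>n 0\<close> and \<open>n 1\<close> the
  roots of t^2 - t + |bcd|^2, the characteristic polynomial of
  \<open>M M\<^sup>\<dagger>\<close>.\<close>

lemma n_mult: "n 0 * n 1 = (cmod (b * c * d))\<^sup>2"
proof -
  have "(sqrt (1 - 4 * (cmod (b * c * d))\<^sup>2))\<^sup>2 = 1 - 4 * (cmod (b * c * d))\<^sup>2"
    using disc_pos by simp
  then show ?thesis
    unfolding n_eq by (simp add: power2_eq_square algebra_simps)
qed

lemma nu_pos:
  assumes "j < 2"
  shows "nu b c d j > 0"
proof -
  have "nu b c d j \<noteq> 0"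
    using n_mult nz less_2_cases[OF assms] by auto
  then show ?thesis
    using nu_nonneg[of j] by simp
qed

lemma n_swap:
  assumes "j < 2"
  shows "n ((j + 1) mod 2) = 1 - n j" "n j * n ((j + 1) mod 2) = (cmod (b * c * d))\<^sup>2"
  using assms n_sum n_mult by (auto simp: less_2_cases_iff mult.commute)

text \<open>Complex copy of \<open>n j\<close> for polynomial reasoning; not the matrix called
  \<open>N\<close> in the opening comment.\<close>

abbreviation N :: "nat \<Rightarrow> complex" where "N j \<equiv> of_real (n j)"

text \<open>With moduli written as z times its conjugate, later identities become polynomial
  consequences of these relations, \<open>ab_cnj\<close> and \<open>cd_cnj\<close>, within reach of
  \<open>algebra\<close>.\<close>

lemma N_swap:
  assumes "j < 2"
  shows "N ((j + 1) mod 2) = 1 - N j"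
    and "N j * N j = N j - b * cnj b * (c * cnj c) * (d * cnj d)"
proof -
  show 1: "N ((j + 1) mod 2) = 1 - N j"
    using n_swap(1)[OF assms] by simp
  have "N j * N ((j + 1) mod 2) = of_real ((cmod (b * c * d))\<^sup>2)"
    by (simp only: of_real_mult[symmetric] n_swap(2)[OF assms])
  also have "\<dots> = b * cnj b * (c * cnj c) * (d * cnj d)"
    unfolding complex_norm_square by (simp add: mult_ac)
  finally show "N j * N j = N j - b * cnj b * (c * cnj c) * (d * cnj d)"
    unfolding 1 by algebra
qed

section \<open>The singular vectors: coordinates, orthogonality, squared norms\<close>

lemma xvec_nth:
  "xvec a b c d j $ 1 = c * (N j - b * cnj b * (d * cnj d))"
  "xvec a b c d j $ 2 = - cnj a * d * N j"
  unfolding xvec_def of_real_diff complex_norm_square[of "b * d"] by (simp_all add: mult_ac)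

lemma yvec_nth:
  "yvec a b c d j $ 1 = - cnj a * b * (d * cnj d)"
  "yvec a b c d j $ 2 = N j - b * cnj b * (d * cnj d)"
  unfolding yvec_def of_real_diff complex_norm_square[of "b * d"] complex_norm_square[of d]
  by (simp_all add: mult_ac)

text \<open>These are the coordinates of \<open>yvec\<close> with c and d exchanged, an exchange
  that leaves \<open>n j\<close> unchanged.\<close>

lemma wvec_nth:
  "wvec a b c d j $ 1 = - cnj a * b * (c * cnj c)"
  "wvec a b c d j $ 2 = N j - b * cnj b * (c * cnj c)"
  unfolding wvec_def of_real_diff complex_norm_square[of "b * c"] complex_norm_square[of c]
  by (simp_all add: vec_cnj_def mult_ac)

lemma xvec_nonzero: "j < 2 \<Longrightarrow> xvec a b c d j \<noteq> 0"
  using xvec_nth(2)[of j] nu_pos[of j] nz by auto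

lemma yvec_nonzero: "yvec a b c d j \<noteq> 0"
  using yvec_nth(1)[of j] nz by auto

lemma wvec_nonzero: "wvec a b c d j \<noteq> 0"
  using wvec_nth(1)[of j] nz by auto

text \<open>The two vectors are eigenvectors of \<open>M M\<^sup>\<dagger>\<close> for the
  eigenvalues \<open>n i\<close> and \<open>n j\<close>; replacing \<open>N i\<close> by
  \<open>1 - N j\<close> leaves a polynomial identity.\<close>

lemma xvec_orth:
  assumes "i < 2" "j < 2" "i \<noteq> j"
  shows "cinner (xvec a b c d i) (xvec a b c d j) = 0"
proof -
  have i: "i = (j + 1) mod 2"
    using assms by (auto simp: less_2_cases_iff)
  show ?thesis
    using N_swap[OF assms(2)] ab_cnj cd_cnj
    unfolding i cinner_qubit xvec_nth
    by (simp only: complex_cnj_mult complex_cnj_diff complex_cnj_minus complex_cnj_cnj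
        complex_cnj_complex_of_real complex_cnj_one) algebra
qed

lemma wvec_orth:
  assumes "i < 2" "j < 2" "i \<noteq> j"
  shows "cinner (wvec a b c d i) (wvec a b c d j) = 0"
proof -
  have i: "i = (j + 1) mod 2"
    using assms by (auto simp: less_2_cases_iff)
  show ?thesis
    using N_swap[OF assms(2)] ab_cnj cd_cnj
    unfolding i cinner_qubit wvec_nth
    by (simp only: complex_cnj_mult complex_cnj_diff complex_cnj_minus complex_cnj_cnj
        complex_cnj_complex_of_real complex_cnj_one) algebra
qed

text \<open>Compare the squared norms in \<open>x\<^sub>j\<^sup>\<dagger> M = \<nu>\<^sub>j\<^sup>2
  y\<^sub>j\<^sup>\<dagger>\<close>: the left one is \<open>\<nu>\<^sub>j\<^sup>2\<close> times that
  of \<open>x\<^sub>j\<close>, so one factor cancels.\<close>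

lemma cinner_yvec:
  assumes "j < 2"
  shows "N j * cinner (yvec a b c d j) (yvec a b c d j) = cinner (xvec a b c d j) (xvec a b c d j)"
  using N_swap[OF assms] ab_cnj cd_cnj
  unfolding cinner_qubit yvec_nth xvec_nth
  by (simp only: complex_cnj_mult complex_cnj_diff complex_cnj_minus complex_cnj_cnj
      complex_cnj_complex_of_real complex_cnj_one) algebra

text \<open>The analogue for the second matrix: there the swapped vector has eigenvalue
  \<open>1 - n ((j + 1) mod 2)\<close>, which is \<open>n j\<close>.\<close>

lemma cinner_wvec:
  assumes "j < 2"
  shows "d * cnj d * (1 - N j) * (1 - N j) * cinner (wvec a b c d j) (wvec a b c d j)
    = c * cnj c * N j * cinner (xvec a b c d ((j + 1) mod 2)) (xvec a b c d ((j + 1) mod 2))"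
  using N_swap[OF assms] ab_cnj cd_cnj
  unfolding cinner_qubit wvec_nth xvec_nth
  by (simp only: complex_cnj_mult complex_cnj_diff complex_cnj_minus complex_cnj_cnj
      complex_cnj_complex_of_real complex_cnj_one of_real_1) algebra

text \<open>The vectors orthogonal to both product states.\<close>

definition perp :: "complex \<Rightarrow> complex \<Rightarrow> qubit2" where
  "perp p q = p *s (ket0 \<otimes>\<^sub>q ket1)
     + q *s (cnj b *s (ket1 \<otimes>\<^sub>q ket0) - cnj a *s (ket1 \<otimes>\<^sub>q ket1))"

lemma perp_nth:
  "perp p q $ (1, 1) = 0" "perp p q $ (1, 2) = p"
  "perp p q $ (2, 1) = q * cnj b" "perp p q $ (2, 2) = - q * cnj a"
  by (simp_all add: perp_def tensor_def ket0_def ket1_def)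

section \<open>Norm ratios and contractions of the two coefficient matrices\<close>

lemma norm_yvec:
  assumes "j < 2"
  shows "n j * norm (yvec a b c d j) = nu b c d j * norm (xvec a b c d j)"
proof -
  have "complex_of_real (n j * (norm (yvec a b c d j))\<^sup>2) = of_real ((norm (xvec a b c d j))\<^sup>2)"
    using cinner_yvec[OF assms] by (simp only: cinner_self of_real_mult)
  then have "(nu b c d j * norm (yvec a b c d j))\<^sup>2 = (norm (xvec a b c d j))\<^sup>2"
    unfolding of_real_eq_iff by (simp add: power_mult_distrib)
  then have "nu b c d j * norm (yvec a b c d j) = norm (xvec a b c d j)"
    using nu_nonneg[of j] by (simp add: power2_eq_iff_nonneg)
  then show ?thesis
    by (simp add: power2_eq_square mult.assoc)
qed

lemma norm_wvec:
  assumes "j < 2"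
  shows "cmod d * (1 - n j) * norm (wvec a b c d j)
    = cmod c * nu b c d j * norm (xvec a b c d ((j + 1) mod 2))"
proof -
  \<comment> \<open>This is the other square \<open>n ((j + 1) mod 2)\<close>; its sign permits
    taking roots below.\<close>
  have "1 - n j \<ge> 0"
    using n_swap(1)[OF assms] by (metis zero_le_power2)
  have "complex_of_real ((cmod d)\<^sup>2 * (1 - n j) * (1 - n j) * (norm (wvec a b c d j))\<^sup>2)
     = of_real ((cmod c)\<^sup>2 * n j * (norm (xvec a b c d ((j + 1) mod 2)))\<^sup>2)"
    using cinner_wvec[OF assms]
    by (simp only: cinner_self of_real_mult of_real_diff of_real_1 complex_norm_square)
  then have "(cmod d * (1 - n j) * norm (wvec a b c d j))\<^sup>2
    = (cmod c * nu b c d j * norm (xvec a b c d ((j + 1) mod 2)))\<^sup>2"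
    unfolding of_real_eq_iff by (simp add: power2_eq_square mult_ac)
  then show ?thesis
    using nu_nonneg[of j] \<open>1 - n j \<ge> 0\<close> by (simp add: power2_eq_iff_nonneg)
qed

text \<open>The first column of \<open>M\<close> has one non-zero entry, so k = 1 is direct; k = 2
  is the quadratic equation for \<open>N j\<close>.\<close>

lemma xvec_perp:
  assumes "j < 2"
  shows "cnj (xvec a b c d j $ 1) * perp c d $ (1, k) + cnj (xvec a b c d j $ 2) * perp c d $ (2, k)
    = N j * cnj (yvec a b c d j $ k)"
  using exhaust_2[of k]
proof
  assume "k = 1"
  then show ?thesis
    by (simp add: yvec_nth xvec_nth perp_nth)
next
  assume k: "k = 2"
  show ?thesis
    using N_swap[OF assms] ab_cnj cd_cnj
    unfolding k yvec_nth xvec_nth perp_nth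
    by (simp only: complex_cnj_mult complex_cnj_diff complex_cnj_minus complex_cnj_cnj
        complex_cnj_complex_of_real complex_cnj_one) algebra
qed

text \<open>The factor \<open>c * cnj c\<close> clears a denominator. The phase of
  \<open>- cnj c * cnj d\<close> does not depend on j, so it can be removed globally.\<close>

lemma xvec_perp_swap:
  assumes "j < 2"
  shows "c * cnj c * (cnj (xvec a b c d ((j + 1) mod 2) $ 1) * perp (cnj d) (- cnj c) $ (1, k)
      + cnj (xvec a b c d ((j + 1) mod 2) $ 2) * perp (cnj d) (- cnj c) $ (2, k))
    = - cnj c * cnj d * (1 - N j) * cnj (wvec a b c d j $ k)"
  using exhaust_2[of k]
proof
  assume k: "k = 1"
  show ?thesis
    unfolding k wvec_nth xvec_nth perp_nth N_swap(1)[OF assms] by simp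
next
  assume k: "k = 2"
  show ?thesis
    using N_swap[OF assms] ab_cnj cd_cnj
    unfolding k wvec_nth xvec_nth perp_nth
    by (simp only: complex_cnj_mult complex_cnj_diff complex_cnj_minus complex_cnj_cnj
        complex_cnj_complex_of_real complex_cnj_one) algebra
qed

section \<open>Schmidt decompositions of both entangled states\<close>

lemma xvec_orthonormal:
  "orthonormal_family {..<2} (\<lambda>j. xvec a b c d j /\<^sub>R norm (xvec a b c d j))"
  by (rule orthonormal_family_normalize) (auto simp: xvec_nonzero xvec_orth)

lemma xvec_swap_orthonormal:
  "orthonormal_family {..<2}
     (\<lambda>j. xvec a b c d ((j + 1) mod 2) /\<^sub>R norm (xvec a b c d ((j + 1) mod 2)))"
proof (rule orthonormal_family_normalize)
  fix i j :: nat
  assume ij: "i \<in> {..<2}" "j \<in> {..<2}" "i \<noteq> j"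
  then have "(i + 1) mod 2 \<noteq> (j + 1) mod 2"
    by (auto simp: less_2_cases_iff)
  then show "cinner (xvec a b c d ((i + 1) mod 2)) (xvec a b c d ((j + 1) mod 2)) = 0"
    by (intro xvec_orth) auto
qed (rule xvec_nonzero, simp)

lemma wvec_orthonormal:
  "orthonormal_family {..<2} (\<lambda>j. vec_cnj (wvec a b c d j) /\<^sub>R norm (wvec a b c d j))"
proof -
  have "orthonormal_family {..<2}
      (\<lambda>j. vec_cnj (wvec a b c d j) /\<^sub>R norm (vec_cnj (wvec a b c d j)))"
    by (rule orthonormal_family_normalize)
      (auto simp: vec_cnj_nonzero wvec_nonzero wvec_orth cinner_vec_cnj)
  then show ?thesis
    by (simp add: norm_vec_cnj)
qed

lemma ppEe_eq:
  "perp c d = (\<Sum>j<2. nu b c d j *\<^sub>R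
     ((xvec a b c d j /\<^sub>R norm (xvec a b c d j)) \<otimes>\<^sub>q
      (vec_cnj (yvec a b c d j) /\<^sub>R norm (yvec a b c d j))))"
  using schmidt_expansion_normalized[of "xvec a b c d" "\<lambda>j. vec_cnj (yvec a b c d j)" "perp c d" n
      "nu b c d"]
  by (simp add: xvec_orthonormal xvec_nonzero vec_cnj_nonzero yvec_nonzero xvec_perp norm_yvec
      norm_vec_cnj vec_cnj_nth del: of_real_power)

text \<open>The scalar in front is the inverse of the common phase in \<open>xvec_perp_swap\<close>,
  which makes all coefficients real and non-negative.\<close>

lemma ppeE_schmidt:
  "schmidt_decomposition ((- (c * d) / of_real (cmod (c * d))) *s perp (cnj d) (- cnj c))
     {..<2} (nu b c d)
     (\<lambda>j. xvec a b c d ((j + 1) mod 2) /\<^sub>R norm (xvec a b c d ((j + 1) mod 2)))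
     (\<lambda>j. vec_cnj (wvec a b c d j) /\<^sub>R norm (wvec a b c d j))"
proof -
  let ?x = "\<lambda>j. xvec a b c d ((j + 1) mod 2)" and ?w = "\<lambda>j. vec_cnj (wvec a b c d j)"
  let ?g = "- (c * d) / of_real (cmod (c * d))"
  let ?\<psi> = "?g *s perp (cnj d) (- cnj c)"
  \<comment> \<open>What remains of the factor in \<open>xvec_perp_swap\<close> after multiplying by
    \<open>?g\<close> and dividing by |c|^2.\<close>
  let ?\<kappa> = "\<lambda>j. cmod d * (1 - n j) / cmod c"
  have "?\<psi> = (\<Sum>j<2. nu b c d j *\<^sub>R ((?x j /\<^sub>R norm (?x j)) \<otimes>\<^sub>q (?w j /\<^sub>R norm (?w j))))"
  proof (rule schmidt_expansion_normalized[where \<kappa> = ?\<kappa>])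
    show "orthonormal_family {..<2} (\<lambda>j. ?x j /\<^sub>R norm (?x j))"
      by (rule xvec_swap_orthonormal)
    show "?x j \<noteq> 0" if "j < 2" for j :: nat
      by (rule xvec_nonzero) simp
    show "?w j \<noteq> 0" if "j < 2" for j :: nat
      by (simp add: vec_cnj_nonzero wvec_nonzero)
    show "?\<kappa> j * norm (?w j) = nu b c d j * norm (?x j)" if "j < 2" for j
      using norm_wvec[OF that] nz by (simp add: norm_vec_cnj field_simps)
    show "cnj (?x j $ 1) * ?\<psi> $ (1, k) + cnj (?x j $ 2) * ?\<psi> $ (2, k) = of_real (?\<kappa> j) * ?w j $ k"
      if "j < 2" for j k
    proof -
      let ?C = "complex_of_real (cmod c)" and ?D = "complex_of_real (cmod d)"
      have C: "c * cnj c = ?C * ?C" and D: "d * cnj d = ?D * ?D"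
        by (simp_all only: complex_norm_square[symmetric] power2_eq_square of_real_mult)
      have nzC: "?C \<noteq> 0" "?D \<noteq> 0"
        using nz by simp_all
      let ?S = "cnj (?x j $ 1) * perp (cnj d) (- cnj c) $ (1, k)
        + cnj (?x j $ 2) * perp (cnj d) (- cnj c) $ (2, k)"
      have "cnj (?x j $ 1) * ?\<psi> $ (1, k) + cnj (?x j $ 2) * ?\<psi> $ (2, k) = ?g * ?S"
        by (simp add: algebra_simps)
      \<comment> \<open>Expanding the fraction by |c|^2 produces the left-hand side of
        \<open>xvec_perp_swap\<close>.\<close>
      also have "?g * ?S = - (c * d) * (c * cnj c * ?S) / (?C * ?D * (?C * ?C))"
        unfolding C using nzC by (simp add: norm_mult mult_ac)
      also have "\<dots> = (c * cnj c) * (d * cnj d) * (1 - N j) * cnj (wvec a b c d j $ k)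
          / (?C * ?D * (?C * ?C))"
        unfolding xvec_perp_swap[OF that] by (simp add: mult_ac)
      also have "\<dots> = ?D * (1 - N j) / ?C * cnj (wvec a b c d j $ k)"
        unfolding C D using nzC by (simp add: field_simps)
      finally show ?thesis
        by (simp add: vec_cnj_nth)
    qed
  qed
  then show ?thesis
    unfolding schmidt_decomposition_def
    using nu_nonneg xvec_swap_orthonormal wvec_orthonormal by (simp add: norm_vec_cnj)
qed

section \<open>The one-dimensional complement of the three known basis states\<close>

lemma orthogonal_perp:
  assumes "cinner (ket0 \<otimes>\<^sub>q ket0) \<psi> = 0"
    and "cinner (a *s (ket1 \<otimes>\<^sub>q ket0) + b *s (ket1 \<otimes>\<^sub>q ket1)) \<psi> = 0"
    and "cinner (perp c d) \<psi> = 0"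
  obtains t where "\<psi> = t *s perp (cnj d) (- cnj c)"
proof -
  \<comment> \<open>\<open>s\<close> is the coefficient of the second row along
    (\<open>cnj b\<close>, \<open>- cnj a\<close>); \<open>t\<close> is that of
    (\<open>\<psi> $ (1, 2)\<close>, \<open>s\<close>) along (\<open>cnj d\<close>,
    \<open>- cnj c\<close>).\<close>
  define s where "s = b * \<psi> $ (2, 1) - a * \<psi> $ (2, 2)"
  define t where "t = d * \<psi> $ (1, 2) - c * s"
  have 1: "\<psi> $ (1, 1) = 0"
    using assms(1) by (simp add: cinner_qubit2 tensor_def ket0_def)
  have 2: "cnj a * \<psi> $ (2, 1) + cnj b * \<psi> $ (2, 2) = 0"
    using assms(2) by (simp add: cinner_qubit2 tensor_def ket0_def ket1_def)
  have 3: "cnj c * \<psi> $ (1, 2) + cnj d * s = 0"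
    using assms(3) by (simp add: cinner_qubit2 perp_nth s_def algebra_simps)
  have 4: "\<psi> $ (2, 1) = s * cnj b" "\<psi> $ (2, 2) = - s * cnj a"
    using 2 ab_cnj unfolding s_def by algebra+
  have 5: "\<psi> $ (1, 2) = t * cnj d" "s = - t * cnj c"
    using 3 cd_cnj unfolding t_def by algebra+
  have "\<psi> $ (i, k) = (t *s perp (cnj d) (- cnj c)) $ (i, k)" for i k
    using exhaust_2[of i] exhaust_2[of k] 1 4 5 by (auto simp: perp_nth)
  then have "\<psi> = t *s perp (cnj d) (- cnj c)"
    by (simp add: vec_eq_iff)
  then show thesis ..
qed

lemma cinner_perp_self:
  "cinner (t *s perp (cnj d) (- cnj c)) (t *s perp (cnj d) (- cnj c)) = t * cnj t"
  using ab_cnj cd_cnj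
  by (simp only: cinner_qubit2 vector_smult_component perp_nth complex_cnj_mult
      complex_cnj_minus complex_cnj_cnj complex_cnj_zero) algebra

end

section \<open>Identification of the fourth basis state\<close>

theorem theorem17:
  fixes a b c d :: complex and B :: "qubit2 set" and \<phi> \<psi> :: qubit2
  assumes "a \<noteq> 0" "b \<noteq> 0" "c \<noteq> 0" "d \<noteq> 0"
    and "(cmod a)\<^sup>2 + (cmod b)\<^sup>2 = 1" "(cmod c)\<^sup>2 + (cmod d)\<^sup>2 = 1"
    and "orthonormal_basis B"
    and "card {\<xi> \<in> B. product_state \<xi>} = 2" "card {\<xi> \<in> B. entangled_state \<xi>} = 2"
    and "ket0 \<otimes>\<^sub>q ket0 \<in> B"
    and "a *s (ket1 \<otimes>\<^sub>q ket0) + b *s (ket1 \<otimes>\<^sub>q ket1) \<in> B"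
    and "\<phi> = (\<Sum>j<2. nu b c d j *\<^sub>R
           ((xvec a b c d j /\<^sub>R norm (xvec a b c d j)) \<otimes>\<^sub>q
            (vec_cnj (yvec a b c d j) /\<^sub>R norm (yvec a b c d j))))"
    and "\<phi> \<in> B" "entangled_state \<phi>"
    and "\<psi> \<in> B" "entangled_state \<psi>" "\<psi> \<noteq> \<phi>"
  shows "\<exists>\<gamma>::complex. cmod \<gamma> = 1 \<and>
    schmidt_decomposition (\<gamma> *s \<psi>) {..<2} (nu b c d)
      (\<lambda>j. xvec a b c d ((j + 1) mod 2) /\<^sub>R norm (xvec a b c d ((j + 1) mod 2)))
      (\<lambda>j. vec_cnj (wvec a b c d j) /\<^sub>R norm (wvec a b c d j))"
proof -
  interpret amplitudes a b c d
    using assms(1-6) by unfold_locales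
  note \<phi> = assms(12)[folded ppEe_eq]
  have ob: "orthonormal_family B (\<lambda>\<psi>. \<psi>)"
    using assms(7) by (simp add: orthonormal_basis_def)
  have orth: "cinner \<xi> \<psi> = 0" if "\<xi> \<in> B" "\<xi> \<noteq> \<psi>" for \<xi>
    using ob that assms(15) by (simp add: orthonormal_family_def)
  have state: "is_state \<xi>" if "\<xi> \<in> B" for \<xi>
  proof -
    have "complex_of_real ((norm \<xi>)\<^sup>2) = of_real 1"
      using ob that cinner_self[of \<xi>] by (simp add: orthonormal_family_def)
    then have "(norm \<xi>)\<^sup>2 = 1"
      unfolding of_real_eq_iff .
    then show ?thesis
      unfolding is_state_def power2_eq_1_iff by (smt (verit) norm_ge_zero)
  qed
  have not_\<psi>: "u \<otimes>\<^sub>q v \<noteq> \<psi>" if "u \<otimes>\<^sub>q v \<in> B" for u v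
    using assms(16) state[OF that] by (auto simp: entangled_state_def product_state_def)
  \<comment> \<open>The factored form lets \<open>not_\<psi>\<close> separate this basis element
    from \<open>\<psi>\<close>.\<close>
  have ket1_tensor: "a *s (ket1 \<otimes>\<^sub>q ket0) + b *s (ket1 \<otimes>\<^sub>q ket1) = ket1 \<otimes>\<^sub>q (a *s ket0 + b *s ket1)"
    by (simp add: tensor_def vec_eq_iff algebra_simps)
  obtain t where t: "\<psi> = t *s perp (cnj d) (- cnj c)"
  proof (rule orthogonal_perp)
    show "cinner (ket0 \<otimes>\<^sub>q ket0) \<psi> = 0"
      using assms(10) not_\<psi> orth by blast
    show "cinner (a *s (ket1 \<otimes>\<^sub>q ket0) + b *s (ket1 \<otimes>\<^sub>q ket1)) \<psi> = 0"
      using assms(11) not_\<psi> orth unfolding ket1_tensor by blast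
    show "cinner (perp c d) \<psi> = 0"
      using assms(13,17) orth unfolding \<phi> by blast
  qed
  have "t * cnj t = 1"
    using ob assms(15) cinner_perp_self[of t] unfolding t by (simp add: orthonormal_family_def)
  then have "cmod t * cmod t = 1"
    by (metis complex_mod_cnj norm_mult norm_one)
  then have t1: "cmod t = 1"
    unfolding square_eq_1_iff by (smt (verit) norm_ge_zero)
  \<comment> \<open>\<open>cnj t\<close> undoes the unit scalar \<open>t\<close>; the other factor
    is the phase required by \<open>ppeE_schmidt\<close>.\<close>
  define \<gamma> where "\<gamma> = cnj t * (- (c * d) / of_real (cmod (c * d)))"
  have "cmod \<gamma> = 1"
    using t1 nz by (simp add: \<gamma>_def norm_mult norm_divide)
  moreover have "\<gamma> *s \<psi> = (- (c * d) / of_real (cmod (c * d))) *s perp (cnj d) (- cnj c)"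
    using \<open>t * cnj t = 1\<close> unfolding t \<gamma>_def vector_smult_assoc by (simp add: mult_ac)
  ultimately show ?thesis
    using ppeE_schmidt by (intro exI[of _ \<gamma>] conjI) (simp_all only:)
qed

end
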